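(* Let $\mathbb T$ be a time scale and $a,b\in\mathbb T$ with $a<b$. Let $f,g:\mathbb T\to\mathbb R$ be $\diamondsuit$-integrable on $[a,b]_{\mathbb T}$. Then $$\int_a^b|f(t)g(t)|\,\diamondsuit t\le\left(\int_a^b|f(t)|^p\,\diamondsuit t\right)^{\frac1p}\left(\int_a^b|g(t)|^q\,\diamondsuit t\right)^{\frac1q},$$ where $p>1$ and $q=\frac{p}{p-1}$.
   Context: A time scale $\mathbb T$ is a nonempty closed subset of $\mathbb R$. $\sigma(t)=\inf\{s\in\mathbb T:s>t\}$, $\rho(t)=\sup\{s\in\mathbb T:s<t\}$, with $\inf\emptyset=\sup\mathbb T$, $\sup\emptyset=\inf\mathbb T$. $[a,b]_{\mathbb T}=\{t\in\mathbb T:a\le t\le b\}$, and half-open intervals similarly. Define $\gamma_1,\gamma_2:\mathbb T\to\mathbb R$ by $$\gamma_1(t)=\lim_{s\to t}\frac{\sigma(t)-s}{\sigma(t)+2t-2s-\rho(t)},\qquad\gamma_2(t)=\lim_{s\to t}\frac{(2t-s)-\rho(t)}{\sigma(t)+2t-2s-\rho(t)}$$ (limits over the real variable $s\ne t$). The diamond integral of $f$ from $a$ to $b$ is $$\int_a^bf(t)\,\diamondsuit t=\int_a^b\gamma_1(t)f(t)\,\Delta t+\int_a^b\gamma_2(t)f(t)\,\nabla t,$$ provided $\gamma_1f$ is delta integrable and $\gamma_2f$ is nabla integrable on $[a,b]_{\mathbb T}$; then $f$ is called $\diamondsuit$-integrable on $[a,b]_{\mathbb T}$. Delta and nabla integrals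 are the standard (Riemann) time scale integrals: the delta (resp. nabla) integral is the limit as $\delta\to0^+$ of sums $\sum_if(\xi_i)(t_i-t_{i-1})$ with $\xi_i\in[t_{i-1},t_i)_{\mathbb T}$ (resp. $\xi_i\in(t_{i-1},t_i]_{\mathbb T}$) over partitions $a=t_0<\dots<t_n=b$ in $\mathbb T$ such that for each $i$ either $t_i-t_{i-1}\le\delta$, or $t_i-t_{i-1}>\delta$ and $\rho(t_i)=t_{i-1}$. If $f$ is integrable and $F^\Delta=f$ (resp. $F^\nabla=f$), the integral equals $F(b)-F(a)$. *)

theory Defs
  imports "HOL-Analysis.Analysis"
begin

definition time_scale :: "real set \<Rightarrow> bool" where
  "time_scale T \<longleftrightarrow> T \<noteq> {} \<and> closed T"

text \<open>The jump operators carry the conventions that the infimum of the empty set is the supremum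
  of \<open>T\<close> and the supremum of the empty set is the infimum of \<open>T\<close>; for \<open>t\<close> in \<open>T\<close> these cases
  only occur when the relevant bound of \<open>T\<close> exists.\<close>

definition forward_jump :: "real set \<Rightarrow> real \<Rightarrow> real" where
  "forward_jump T t = (if {s \<in> T. s > t} = {} then Sup T else Inf {s \<in> T. s > t})"

definition backward_jump :: "real set \<Rightarrow> real \<Rightarrow> real" where
  "backward_jump T t = (if {s \<in> T. s < t} = {} then Inf T else Sup {s \<in> T. s < t})"

text \<open>In the weights, \<open>s\<close> tends to \<open>t\<close> through all real numbers other than \<open>t\<close>, not only through
  the time scale.\<close>

definition gamma1 :: "real set \<Rightarrow> real \<Rightarrow> real" where
  "gamma1 T t = Lim (at t) (\<lambda>s. (forward_jump T t - s) /
     (forward_jump T t + 2 * t - 2 * s - backward_jump T t))"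

definition gamma2 :: "real set \<Rightarrow> real \<Rightarrow> real" where
  "gamma2 T t = Lim (at t) (\<lambda>s. ((2 * t - s) - backward_jump T t) /
     (forward_jump T t + 2 * t - 2 * s - backward_jump T t))"

definition ts_partition :: "real set \<Rightarrow> real \<Rightarrow> real \<Rightarrow> real \<Rightarrow> nat \<Rightarrow> (nat \<Rightarrow> real) \<Rightarrow> bool" where
  "ts_partition T a b \<delta> n t \<longleftrightarrow>
     t 0 = a \<and> t n = b \<and> (\<forall>i\<le>n. t i \<in> T) \<and> (\<forall>i<n. t i < t (Suc i)) \<and>
     (\<forall>i<n. t (Suc i) - t i \<le> \<delta> \<or>
            (t (Suc i) - t i > \<delta> \<and> backward_jump T (t (Suc i)) = t i))"

text \<open>Every partition admitted for some \<open>\<delta>\<close> is admitted for all larger ones, so the limit as \<open>\<delta>\<close>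
  tends to \<open>0\<close> from the right is expressed by the existence of one suitable \<open>\<delta>\<close> for each \<open>\<epsilon>\<close>.
  The tag of the \<open>i\<close>-th subinterval (counted from \<open>0\<close>) is \<open>\<xi> i\<close>.\<close>

definition has_delta_integral ::
    "real set \<Rightarrow> real \<Rightarrow> real \<Rightarrow> (real \<Rightarrow> real) \<Rightarrow> real \<Rightarrow> bool" where
  "has_delta_integral T a b f I \<longleftrightarrow>
     (\<forall>\<epsilon>>0. \<exists>\<delta>>0. \<forall>n t \<xi>.
        ts_partition T a b \<delta> n t \<and> (\<forall>i<n. \<xi> i \<in> T \<inter> {t i..<t (Suc i)}) \<longrightarrow>
        \<bar>(\<Sum>i<n. f (\<xi> i) * (t (Suc i) - t i)) - I\<bar> < \<epsilon>)"

definition has_nabla_integral ::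
    "real set \<Rightarrow> real \<Rightarrow> real \<Rightarrow> (real \<Rightarrow> real) \<Rightarrow> real \<Rightarrow> bool" where
  "has_nabla_integral T a b f I \<longleftrightarrow>
     (\<forall>\<epsilon>>0. \<exists>\<delta>>0. \<forall>n t \<xi>.
        ts_partition T a b \<delta> n t \<and> (\<forall>i<n. \<xi> i \<in> T \<inter> {t i<..t (Suc i)}) \<longrightarrow>
        \<bar>(\<Sum>i<n. f (\<xi> i) * (t (Suc i) - t i)) - I\<bar> < \<epsilon>)"

definition delta_integrable :: "real set \<Rightarrow> real \<Rightarrow> real \<Rightarrow> (real \<Rightarrow> real) \<Rightarrow> bool" where
  "delta_integrable T a b f \<longleftrightarrow> (\<exists>I. has_delta_integral T a b f I)"

definition nabla_integrable :: "real set \<Rightarrow> real \<Rightarrow> real \<Rightarrow> (real \<Rightarrow> real) \<Rightarrow> bool" where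
  "nabla_integrable T a b f \<longleftrightarrow> (\<exists>I. has_nabla_integral T a b f I)"

definition delta_integral :: "real set \<Rightarrow> real \<Rightarrow> real \<Rightarrow> (real \<Rightarrow> real) \<Rightarrow> real" where
  "delta_integral T a b f = (THE I. has_delta_integral T a b f I)"

definition nabla_integral :: "real set \<Rightarrow> real \<Rightarrow> real \<Rightarrow> (real \<Rightarrow> real) \<Rightarrow> real" where
  "nabla_integral T a b f = (THE I. has_nabla_integral T a b f I)"

definition diamond_integrable :: "real set \<Rightarrow> real \<Rightarrow> real \<Rightarrow> (real \<Rightarrow> real) \<Rightarrow> bool" where
  "diamond_integrable T a b f \<longleftrightarrow>
     delta_integrable T a b (\<lambda>t. gamma1 T t * f t) \<and>
     nabla_integrable T a b (\<lambda>t. gamma2 T t * f t)"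

text \<open>Only meaningful for diamond-integrable functions.\<close>

definition diamond_integral :: "real set \<Rightarrow> real \<Rightarrow> real \<Rightarrow> (real \<Rightarrow> real) \<Rightarrow> real" where
  "diamond_integral T a b f =
     delta_integral T a b (\<lambda>t. gamma1 T t * f t) +
     nabla_integral T a b (\<lambda>t. gamma2 T t * f t)"

end

theory Submission
  imports Defs
begin

text \<open>Delta and nabla integrability on a time scale obey the same Lebesgue criterion: the function
  is bounded and its restriction to \<open>T\<close> is continuous at almost every point of \<open>T\<close> in \<open>(a, b)\<close>.
  On \<open>T\<close> the weights are nonnegative with sum \<open>1\<close>, so \<open>f = gamma1 f + gamma2 f\<close> inherits
  boundedness and almost everywhere continuity from the two weighted functions, although the
  weights may be discontinuous. Hence multiplying a diamond-integrable function by another one, or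
  by a power of its absolute value, preserves diamond integrability. The inequality holds for
  Riemann sums, where the delta and nabla sums over one partition form a single weighted finite
  sum, and passes to the limit.\<close>

section \<open>Partitions of a time scale interval\<close>

text \<open>Since \<open>t i\<close> is itself a point of \<open>T\<close> below
  \<open>t (Suc i)\<close>, the condition on \<open>backward_jump\<close> makes it the largest such
  point. Over such a gap a Riemann sum has no choice of tag.\<close>

lemma ts_partition_gap:
  assumes "ts_partition T a b \<delta> n t" "i < n" "t (Suc i) - t i > \<delta>"
  shows "T \<inter> {t i<..<t (Suc i)} = {}"
proof -
  have "backward_jump T (t (Suc i)) = t i" "t i \<in> T" "t i < t (Suc i)"
    using assms unfolding ts_partition_def by force+
  moreover have "s \<le> Sup {s \<in> T. s < t (Suc i)}" if "s \<in> T" "s < t (Suc i)" for s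
    using that by (intro cSup_upper bdd_aboveI[where M="t (Suc i)"]) auto
  ultimately show ?thesis
    unfolding backward_jump_def by (force split: if_splits)
qed

lemma ts_partition_mono:
  assumes "ts_partition T a b \<delta> n t" "\<delta> \<le> \<delta>'"
  shows "ts_partition T a b \<delta>' n t"
  using assms unfolding ts_partition_def by force

lemma partition_increasing:
  fixes t :: "nat \<Rightarrow> real"
  assumes "\<forall>i<n. t i < t (Suc i)" "i \<le> j" "j \<le> n"
  shows "t i \<le> t j"
  using assms(2,3)
proof (induction j rule: dec_induct)
  case (step j)
  then show ?case using assms(1) by (smt (verit) Suc_le_lessD order.strict_implies_order)
qed auto

lemma partition_locate:
  fixes t :: "nat \<Rightarrow> real"
  assumes "t 0 \<le> x" "x < t n"
  obtains i where "i < n" "t i \<le> x" "x < t (Suc i)"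
proof -
  have "\<exists>i<n. t i \<le> x \<and> x < t (Suc i)"
    using assms(2)
  proof (induction n)
    case (Suc n)
    then show ?case by (cases "x < t n") (auto intro: less_SucI)
  qed (use assms(1) in auto)
  then show ?thesis using that by blast
qed

lemma partition_locate':
  fixes t :: "nat \<Rightarrow> real"
  assumes "t 0 < x" "x \<le> t n"
  obtains i where "i < n" "t i < x" "x \<le> t (Suc i)"
proof -
  have "\<exists>i<n. t i < x \<and> x \<le> t (Suc i)"
    using assms(2)
  proof (induction n)
    case (Suc n)
    then show ?case by (cases "x \<le> t n") (auto intro: less_SucI)
  qed (use assms(1) in auto)
  then show ?thesis using that by blast
qed

lemma ts_partition_extend:
  assumes "ts_partition T a c \<delta> n t" "c < d" "d \<in> T"
    and "d - c \<le> \<delta> \<or> backward_jump T d = c"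
  shows "ts_partition T a d \<delta> (Suc n) (t(Suc n := d))"
  using assms unfolding ts_partition_def
  by (auto simp: less_Suc_eq le_Suc_eq)

text \<open>A supremum argument on the set \<open>S\<close> of points up to which a partition
  exists. The supremum belongs to \<open>S\<close>, and it cannot lie below \<open>b\<close>,
  because from there one can either make a step of length at most \<open>\<delta>\<close> or jump
  across a gap.\<close>

lemma ts_partition_exists:
  assumes "closed T" "a \<in> T" "b \<in> T" "a \<le> b" "\<delta> > 0"
  obtains n t where "ts_partition T a b \<delta> n t"
proof -
  define S where "S = {c \<in> T \<inter> {a..b}. \<exists>n t. ts_partition T a c \<delta> n t}"
  have "ts_partition T a a \<delta> 0 (\<lambda>_. a)" using assms by (auto simp: ts_partition_def)
  then have "a \<in> S" using assms by (auto simp: S_def)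
  have bdd: "bdd_above S" by (rule bdd_aboveI[where M=b]) (auto simp: S_def)
  define c where "c = Sup S"
  have "c \<in> closure S" using \<open>a \<in> S\<close> bdd unfolding c_def by (intro closure_contains_Sup) auto
  moreover have "closure S \<subseteq> T \<inter> {a..b}"
    by (rule closure_minimal) (use assms in \<open>auto simp: S_def\<close>)
  ultimately have c: "c \<in> T" "a \<le> c" "c \<le> b" by auto
  obtain s where s: "s \<in> S" "s > c - \<delta>"
    using less_cSup_iff[of S "c - \<delta>"] \<open>a \<in> S\<close> bdd \<open>\<delta> > 0\<close> by (auto simp: c_def)
  have "s \<le> c" using s bdd unfolding c_def by (intro cSup_upper) auto
  \<comment> \<open>\<open>s\<close> lies within \<open>\<delta>\<close> of \<open>c\<close>, so one
    more subinterval reaches \<open>c\<close>.\<close>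
  have "c \<in> S"
  proof (cases "s = c")
    case False
    with s ts_partition_extend[of T a s \<delta> _ _ c] c \<open>s \<le> c\<close> show ?thesis unfolding S_def by force
  qed (use s in auto)
  then obtain n t where nt: "ts_partition T a c \<delta> n t" by (auto simp: S_def)
  have "c = b"
  proof (rule ccontr)
    assume "c \<noteq> b"
    then have "c < b" using c by auto
    \<comment> \<open>\<open>d\<close> is the next point of \<open>T\<close> after \<open>c\<close>,
      or \<open>c\<close> itself if points of \<open>T\<close> accumulate at \<open>c\<close> from
      the right.\<close>
    define d where "d = Inf (T \<inter> {c<..b})"
    have ne: "T \<inter> {c<..b} \<noteq> {}" using \<open>c < b\<close> assms by auto
    have bb: "bdd_below (T \<inter> {c<..b})" by (rule bdd_belowI[where m=c]) auto
    have "d \<in> closure (T \<inter> {c<..b})" unfolding d_def using closure_contains_Inf[OF ne bb] .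
    moreover have "closure (T \<inter> {c<..b}) \<subseteq> T \<inter> {c..b}"
      by (rule closure_minimal) (use assms in auto)
    ultimately have d: "d \<in> T" "c \<le> d" "d \<le> b" by auto
    have "\<exists>e\<in>T. c < e \<and> e \<le> b \<and> (e - c \<le> \<delta> \<or> backward_jump T e = c)"
    proof (cases "d = c")
      case True
      then obtain e where "e \<in> T \<inter> {c<..b}" "e < c + \<delta>"
        using cInf_less_iff[OF ne bb, of "c + \<delta>"] \<open>\<delta> > 0\<close> by (auto simp: d_def)
      then show ?thesis by force
    next
      case False
      have "x \<le> c" if "x \<in> T" "x < d" for x
      proof (rule ccontr)
        assume "\<not> x \<le> c"
        then have "d \<le> x" unfolding d_def using that d by (intro cInf_lower bb) auto
        then show False using that by auto
      qed
      then have "Sup {x \<in> T. x < d} = c"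
        using d False c by (intro cSup_eq_maximum) auto
      then have "backward_jump T d = c"
        using d False c unfolding backward_jump_def by (auto split: if_splits)
      then show ?thesis using d False by force
    qed
    then obtain e where e: "e \<in> T" "c < e" "e \<le> b" "e - c \<le> \<delta> \<or> backward_jump T e = c" by auto
    have "e \<in> S" using ts_partition_extend[OF nt e(2,1,4)] e c by (auto simp: S_def)
    then have "e \<le> c" using bdd unfolding c_def by (intro cSup_upper)
    then show False using e by auto
  qed
  then show ?thesis using nt that by blast
qed

section \<open>Riemann integrals with half-open tag intervals\<close>

text \<open>The endpoints are left out: they form a null set, and continuity there within
  \<open>T\<close> could depend on values outside \<open>[a, b]\<close>.\<close>

definition ts_discont :: "real set \<Rightarrow> real \<Rightarrow> real \<Rightarrow> (real \<Rightarrow> real) \<Rightarrow> real set" where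
  "ts_discont T a b h = {x \<in> T \<inter> {a<..<b}. \<not> continuous (at x within T) h}"

locale ts_interval =
  fixes T :: "real set" and a b :: real
  assumes closed: "closed T" and a: "a \<in> T" and b: "b \<in> T" and ab: "a < b"

text \<open>The delta and nabla integrals differ only in the half-open interval \<open>J u v\<close> from which
  the tags are taken.\<close>

locale ts_integral = ts_interval +
  fixes J :: "real \<Rightarrow> real \<Rightarrow> real set"
  assumes J: "J = (\<lambda>u v. {u..<v}) \<or> J = (\<lambda>u v. {u<..v})"
begin

definition tagged :: "real \<Rightarrow> nat \<Rightarrow> (nat \<Rightarrow> real) \<Rightarrow> (nat \<Rightarrow> real) \<Rightarrow> bool" where
  "tagged \<delta> n t \<xi> \<longleftrightarrow> ts_partition T a b \<delta> n t \<and> (\<forall>i<n. \<xi> i \<in> T \<inter> J (t i) (t (Suc i)))"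

abbreviation riemann_sum :: "(real \<Rightarrow> real) \<Rightarrow> nat \<Rightarrow> (nat \<Rightarrow> real) \<Rightarrow> (nat \<Rightarrow> real) \<Rightarrow> real" where
  "riemann_sum h n t \<xi> \<equiv> (\<Sum>i<n. h (\<xi> i) * (t (Suc i) - t i))"

definition has_int :: "(real \<Rightarrow> real) \<Rightarrow> real \<Rightarrow> bool" where
  "has_int h I \<longleftrightarrow> (\<forall>\<epsilon>>0. \<exists>\<delta>>0. \<forall>n t \<xi>. tagged \<delta> n t \<xi> \<longrightarrow> \<bar>riemann_sum h n t \<xi> - I\<bar> < \<epsilon>)"

lemma J_bounds: "{u<..<v} \<subseteq> J u v" "J u v \<subseteq> {u..v}"
  using J by auto

lemma J_nonempty: "u < v \<Longrightarrow> u \<in> T \<Longrightarrow> v \<in> T \<Longrightarrow> \<exists>x. x \<in> T \<inter> J u v"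
  using J by auto

text \<open>For left-closed \<open>J\<close> the only candidate is \<open>u\<close>, for
  right-closed \<open>J\<close> it is \<open>v\<close>.\<close>

lemma J_gap: "T \<inter> {u<..<v} = {} \<Longrightarrow> x \<in> T \<inter> J u v \<Longrightarrow> y \<in> T \<inter> J u v \<Longrightarrow> x = y"
  using J by (auto simp: set_eq_iff) (metis less_le)+

lemma J_locate:
  assumes "t 0 = a" "t n = b" "x \<in> J a b"
  obtains i where "i < n" "x \<in> J (t i) (t (Suc i))"
proof (cases "J = (\<lambda>u v. {u..<v})")
  case True
  then obtain i where "i < n" "t i \<le> x" "x < t (Suc i)"
    using assms partition_locate[of t x n] by auto
  with True that show ?thesis by auto
next
  case False
  then have Jn: "J = (\<lambda>u v. {u<..v})" using J by blast
  then obtain i where "i < n" "t i < x" "x \<le> t (Suc i)"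
    using assms partition_locate'[of t x n] by auto
  with Jn that show ?thesis by auto
qed

lemma tags_exist:
  assumes "ts_partition T a b \<delta> n t"
  obtains \<xi> where "tagged \<delta> n t \<xi>"
proof -
  have "\<forall>i. \<exists>x. i < n \<longrightarrow> x \<in> T \<inter> J (t i) (t (Suc i))"
    using assms J_nonempty unfolding ts_partition_def by (meson Suc_leI less_imp_le)
  then show ?thesis using that assms unfolding tagged_def by metis
qed

lemma tagged_exists:
  assumes "\<delta> > 0"
  obtains n t \<xi> where "tagged \<delta> n t \<xi>"
  using ts_partition_exists[OF closed a b _ assms] ab tags_exist by (metis less_imp_le)

lemma tagged_mono: "tagged \<delta> n t \<xi> \<Longrightarrow> \<delta> \<le> \<delta>' \<Longrightarrow> tagged \<delta>' n t \<xi>"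
  unfolding tagged_def using ts_partition_mono by blast

lemma has_int_unique:
  assumes "has_int h I" "has_int h I'"
  shows "I = I'"
proof (rule ccontr)
  assume "I \<noteq> I'"
  then have e: "\<bar>I - I'\<bar> / 2 > 0" by simp
  obtain d where d: "d > 0" "\<And>n t \<xi>. tagged d n t \<xi> \<Longrightarrow> \<bar>riemann_sum h n t \<xi> - I\<bar> < \<bar>I - I'\<bar> / 2"
    using assms(1) e unfolding has_int_def by meson
  obtain d' where d': "d' > 0" "\<And>n t \<xi>. tagged d' n t \<xi> \<Longrightarrow> \<bar>riemann_sum h n t \<xi> - I'\<bar> < \<bar>I - I'\<bar> / 2"
    using assms(2) e unfolding has_int_def by meson
  obtain n t \<xi> where "tagged (min d d') n t \<xi>" using tagged_exists[of "min d d'"] d d' by auto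
  then have "tagged d n t \<xi>" "tagged d' n t \<xi>" by (auto elim: tagged_mono)
  from d(2)[OF this(1)] d'(2)[OF this(2)] show False by (smt (verit) field_sum_of_halves)
qed

lemma tagged_update:
  assumes "tagged \<delta> n t \<xi>" "x \<in> T \<inter> J (t j) (t (Suc j))"
  shows "tagged \<delta> n t (\<xi>(j := x))"
  using assms by (auto simp: tagged_def)

section \<open>Necessity in the Lebesgue criterion\<close>

text \<open>Moving a single tag changes the Riemann sum by the difference of the two values times
  the length of the subinterval. Both sums lie within \<open>1\<close> of \<open>I\<close>, which
  bounds that difference by \<open>2 / (t (Suc j) - t j)\<close>, and finitely many subintervals
  cover \<open>J a b\<close>.\<close>

lemma has_int_bounded:
  assumes "has_int h I"
  shows "bounded (h ` (T \<inter> J a b))"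
proof -
  obtain d where d: "d > 0" "\<And>n t \<xi>. tagged d n t \<xi> \<Longrightarrow> \<bar>riemann_sum h n t \<xi> - I\<bar> < 1"
    using assms unfolding has_int_def by (meson zero_less_one)
  obtain n t \<xi> where tag: "tagged d n t \<xi>" using tagged_exists d(1) by blast
  then have t: "t 0 = a" "t n = b" "\<And>i. i < n \<Longrightarrow> t i < t (Suc i)"
    by (auto simp: tagged_def ts_partition_def)
  define K where "K i = \<bar>h (\<xi> i)\<bar> + 2 / (t (Suc i) - t i)" for i
  have K: "\<bar>h x\<bar> \<le> K j" if "j < n" "x \<in> T \<inter> J (t j) (t (Suc j))" for j x
  proof -
    have "riemann_sum h n t (\<xi>(j := x)) - riemann_sum h n t \<xi>
        = (\<Sum>i<n. if i = j then (h x - h (\<xi> j)) * (t (Suc j) - t j) else 0)"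
      unfolding sum_subtractf[symmetric] by (intro sum.cong) (auto simp: algebra_simps)
    also have "\<dots> = (h x - h (\<xi> j)) * (t (Suc j) - t j)" using that by simp
    finally have "\<bar>(h x - h (\<xi> j)) * (t (Suc j) - t j)\<bar> \<le> 2"
      using d(2)[OF tag] d(2)[OF tagged_update[OF tag that(2)]] by linarith
    then have "\<bar>h x - h (\<xi> j)\<bar> * (t (Suc j) - t j) \<le> 2"
      using t(3)[OF that(1)] by (simp add: abs_mult)
    then have "\<bar>h x - h (\<xi> j)\<bar> \<le> 2 / (t (Suc j) - t j)"
      using t(3)[OF that(1)] by (simp add: field_simps)
    then show ?thesis unfolding K_def by linarith
  qed
  have "\<bar>h x\<bar> \<le> (\<Sum>i<n. K i)" if x: "x \<in> T \<inter> J a b" for x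
  proof -
    obtain j where j: "j < n" "x \<in> J (t j) (t (Suc j))" using J_locate[OF t(1,2)] x by blast
    have "K j \<le> (\<Sum>i<n. K i)"
      by (rule member_le_sum) (use j t(3) in \<open>auto simp: K_def intro!: add_nonneg_nonneg divide_nonneg_pos\<close>)
    then show ?thesis using K[of j x] j x by force
  qed
  then show ?thesis unfolding bounded_iff by (auto intro!: exI[of _ "\<Sum>i<n. K i"])
qed

text \<open>Any two tag choices over one fine partition give sums within
  \<open>\<epsilon> / 2\<close> of \<open>I\<close>. As the tags vary independently in each
  subinterval, this controls the oscillation of \<open>h\<close> weighted by length.\<close>

lemma has_int_osc:
  assumes "has_int h I" "\<epsilon> > 0"
  obtains n t where "t 0 = a" "t n = b" "\<forall>i<n. t i < t (Suc i)"
    "\<forall>\<xi> \<xi>'. (\<forall>i<n. \<xi> i \<in> T \<inter> J (t i) (t (Suc i)) \<and> \<xi>' i \<in> T \<inter> J (t i) (t (Suc i)))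
      \<longrightarrow> (\<Sum>i<n. (h (\<xi> i) - h (\<xi>' i)) * (t (Suc i) - t i)) \<le> \<epsilon>"
    "\<exists>\<xi>. \<forall>i<n. \<xi> i \<in> T \<inter> J (t i) (t (Suc i))"
proof -
  obtain d where d: "d > 0" "\<And>n t \<xi>. tagged d n t \<xi> \<Longrightarrow> \<bar>riemann_sum h n t \<xi> - I\<bar> < \<epsilon> / 2"
    using assms unfolding has_int_def by (meson half_gt_zero)
  obtain n t \<zeta> where tag: "tagged d n t \<zeta>" using tagged_exists d(1) by blast
  show ?thesis
  proof (rule that)
    show "t 0 = a" "t n = b" "\<forall>i<n. t i < t (Suc i)" "\<exists>\<xi>. \<forall>i<n. \<xi> i \<in> T \<inter> J (t i) (t (Suc i))"
      using tag by (auto simp: tagged_def ts_partition_def)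
    show "\<forall>\<xi> \<xi>'. (\<forall>i<n. \<xi> i \<in> T \<inter> J (t i) (t (Suc i)) \<and> \<xi>' i \<in> T \<inter> J (t i) (t (Suc i)))
      \<longrightarrow> (\<Sum>i<n. (h (\<xi> i) - h (\<xi>' i)) * (t (Suc i) - t i)) \<le> \<epsilon>"
    proof (intro allI impI)
      fix \<xi> \<xi>' assume "\<forall>i<n. \<xi> i \<in> T \<inter> J (t i) (t (Suc i)) \<and> \<xi>' i \<in> T \<inter> J (t i) (t (Suc i))"
      then have "tagged d n t \<xi>" "tagged d n t \<xi>'" using tag by (auto simp: tagged_def)
      from d(2)[OF this(1)] d(2)[OF this(2)]
      have "riemann_sum h n t \<xi> - riemann_sum h n t \<xi>' \<le> \<epsilon>" by linarith
      then show "(\<Sum>i<n. (h (\<xi> i) - h (\<xi>' i)) * (t (Suc i) - t i)) \<le> \<epsilon>"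
        by (simp add: sum_subtractf left_diff_distrib)
    qed
  qed
qed

text \<open>Riemann's covering argument: apart from partition points, every point of
  \<open>?D\<close> lies in a subinterval containing two points of \<open>T\<close> where the values
  of \<open>h\<close> differ by at least \<open>\<eta>\<close>, and the oscillation bound forces
  these subintervals to have small total length.\<close>

lemma negligible_osc:
  assumes "has_int h I" "\<eta> > 0"
  shows "negligible {x \<in> T \<inter> {a<..<b}. \<forall>d>0. \<exists>y\<in>T. \<bar>y - x\<bar> < d \<and> \<bar>h y - h x\<bar> \<ge> \<eta>}"
    (is "negligible ?D")
  unfolding negligible_outer_le
proof (intro allI impI)
  fix e :: real assume "e > 0"
  \<comment> \<open>The tolerance \<open>e * \<eta>\<close> leaves total length \<open>e\<close>
    after division by \<open>\<eta>\<close>.\<close>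
  then have "e * \<eta> > 0" using assms by simp
  then obtain n t where
    t: "t 0 = a" "t n = b" "\<forall>i<n. t i < t (Suc i)" and
    osc: "\<forall>\<xi> \<xi>'. (\<forall>i<n. \<xi> i \<in> T \<inter> J (t i) (t (Suc i)) \<and> \<xi>' i \<in> T \<inter> J (t i) (t (Suc i)))
      \<longrightarrow> (\<Sum>i<n. (h (\<xi> i) - h (\<xi>' i)) * (t (Suc i) - t i)) \<le> e * \<eta>" and
    ne: "\<exists>\<xi>. \<forall>i<n. \<xi> i \<in> T \<inter> J (t i) (t (Suc i))"
    by (rule has_int_osc[OF assms(1)])
  \<comment> \<open>Points of the open subinterval are admissible tags for either form of
    \<open>J\<close>.\<close>
  define P where "P i x y \<longleftrightarrow> x \<in> T \<inter> {t i<..<t (Suc i)} \<and> y \<in> T \<inter> {t i<..<t (Suc i)} \<and> h x - h y \<ge> \<eta>" for i x y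
  define B where "B = {i \<in> {..<n}. \<exists>x y. P i x y}"
  \<comment> \<open>Outside \<open>B\<close> the two tags coincide, so only the subintervals in
    \<open>B\<close> contribute to the difference of the sums.\<close>
  have "\<exists>\<xi> \<xi>'. \<forall>i<n. \<xi> i \<in> T \<inter> J (t i) (t (Suc i)) \<and> \<xi>' i \<in> T \<inter> J (t i) (t (Suc i)) \<and>
      (if i \<in> B then h (\<xi> i) - h (\<xi>' i) \<ge> \<eta> else \<xi> i = \<xi>' i)"
  proof -
    have "\<exists>x y. i < n \<longrightarrow> x \<in> T \<inter> J (t i) (t (Suc i)) \<and> y \<in> T \<inter> J (t i) (t (Suc i)) \<and>
      (if i \<in> B then h x - h y \<ge> \<eta> else x = y)" for i
    proof (cases "i \<in> B")
      case True
      then obtain x y where "P i x y" by (auto simp: B_def)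
      then show ?thesis using True J_bounds(1)[of "t i" "t (Suc i)"] unfolding P_def
        by (intro exI[of _ x] exI[of _ y]) auto
    qed (use ne in auto)
    then show ?thesis by metis
  qed
  then obtain \<xi> \<xi>' where xi: "\<And>i. i < n \<Longrightarrow> \<xi> i \<in> T \<inter> J (t i) (t (Suc i))"
     "\<And>i. i < n \<Longrightarrow> \<xi>' i \<in> T \<inter> J (t i) (t (Suc i))"
     "\<And>i. i < n \<Longrightarrow> (if i \<in> B then h (\<xi> i) - h (\<xi>' i) \<ge> \<eta> else \<xi> i = \<xi>' i)" by blast
  have "(\<Sum>i\<in>B. t (Suc i) - t i) * \<eta> = (\<Sum>i<n. if i \<in> B then \<eta> * (t (Suc i) - t i) else 0)"
    unfolding sum_distrib_right by (rule sum.mono_neutral_cong_left) (auto simp: B_def)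
  also have "\<dots> \<le> (\<Sum>i<n. (h (\<xi> i) - h (\<xi>' i)) * (t (Suc i) - t i))"
  proof (rule sum_mono)
    fix i assume "i \<in> {..<n}"
    then show "(if i \<in> B then \<eta> * (t (Suc i) - t i) else 0) \<le> (h (\<xi> i) - h (\<xi>' i)) * (t (Suc i) - t i)"
      using xi(3)[of i] t(3) by (auto intro!: mult_right_mono simp: less_imp_le)
  qed
  also have "\<dots> \<le> e * \<eta>"
    by (rule osc[THEN spec, THEN spec, THEN mp]) (use xi(1,2) in blast)
  finally have small: "(\<Sum>i\<in>B. t (Suc i) - t i) \<le> e" using \<open>\<eta> > 0\<close> by simp
  have finB: "finite B" by (auto simp: B_def)
  define C where "C = (\<Union>i\<in>B. {t i..t (Suc i)})"
  have C: "C \<in> lmeasurable" unfolding C_def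
    by (intro fmeasurable.finite_UN finB) simp
  have "measure lebesgue C \<le> (\<Sum>i\<in>B. measure lebesgue {t i..t (Suc i)})"
    unfolding C_def by (intro measure_UNION_le finB) simp
  also have "\<dots> = (\<Sum>i\<in>B. t (Suc i) - t i)"
    using t(3) by (intro sum.cong) (auto simp: B_def less_imp_le)
  finally have mC: "measure lebesgue C \<le> e" using small by linarith
  have N: "negligible (t ` {..n})" by (intro negligible_finite) simp
  show "\<exists>S. ?D \<subseteq> S \<and> S \<in> lmeasurable \<and> measure lebesgue S \<le> e"
  proof (intro exI[of _ "C \<union> t ` {..n}"] conjI)
    have tN: "t ` {..n} \<in> lmeasurable" using N negligible_imp_measurable by blast
    show "C \<union> t ` {..n} \<in> lmeasurable" using C tN by (rule fmeasurable.Un)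
    have "measure lebesgue (C \<union> t ` {..n}) \<le> measure lebesgue C + measure lebesgue (t ` {..n})"
      using C tN by (intro measure_Un_le) (auto simp: fmeasurable_def)
    then show "measure lebesgue (C \<union> t ` {..n}) \<le> e"
      using mC negligible_imp_measure0[OF N] by linarith
    show "?D \<subseteq> C \<union> t ` {..n}"
    proof
      fix x assume x: "x \<in> ?D"
      then obtain i where i: "i < n" "t i \<le> x" "x < t (Suc i)"
        using partition_locate[of t x n] t by auto
      show "x \<in> C \<union> t ` {..n}"
      proof (cases "t i = x")
        case False
        \<comment> \<open>This \<open>d\<close> keeps \<open>y\<close> in the same open subinterval
          as \<open>x\<close>; the sign of \<open>h y - h x\<close> then decides the order of the
          pair in \<open>P\<close>.\<close>
        define d where "d = min (x - t i) (t (Suc i) - x)"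
        have "d > 0" using i False by (auto simp: d_def)
        then obtain y where y: "y \<in> T" "\<bar>y - x\<bar> < d" "\<bar>h y - h x\<bar> \<ge> \<eta>" using x by blast
        have "P i y x \<or> P i x y" using y x i False unfolding P_def d_def by (auto simp: abs_if split: if_splits)
        then have "i \<in> B" using i by (auto simp: B_def)
        then show ?thesis using i by (force simp: C_def)
      qed (use i in auto)
    qed
  qed
qed

text \<open>A failure of continuity with tolerance \<open>e\<close> puts the point into the set for
  any \<open>inverse (real (Suc m)) < e\<close>, so the discontinuities lie in a countable union of
  null sets.\<close>

lemma has_int_negligible_discont:
  assumes "has_int h I"
  shows "negligible (ts_discont T a b h)"
proof -
  let ?D = "\<lambda>\<eta>. {x \<in> T \<inter> {a<..<b}. \<forall>d>0. \<exists>y\<in>T. \<bar>y - x\<bar> < d \<and> \<bar>h y - h x\<bar> \<ge> \<eta>}"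
  have "ts_discont T a b h \<subseteq> (\<Union>m. ?D (inverse (real (Suc m))))"
  proof
    fix x assume "x \<in> ts_discont T a b h"
    then obtain e where x: "x \<in> T \<inter> {a<..<b}" and e: "e > 0" "\<forall>d>0. \<exists>y\<in>T. dist y x < d \<and> \<not> dist (h y) (h x) < e"
      unfolding ts_discont_def continuous_within_eps_delta by auto
    obtain m where "inverse (real (Suc m)) < e" using reals_Archimedean e(1) by blast
    then have "x \<in> ?D (inverse (real (Suc m)))"
      using x e(2) unfolding dist_real_def not_less by (auto intro: order_trans less_imp_le) (meson less_imp_le order_trans)
    then show "x \<in> (\<Union>m. ?D (inverse (real (Suc m))))" by blast
  qed
  moreover have "negligible (\<Union>m. ?D (inverse (real (Suc m))))"
    by (intro negligible_Union_nat negligible_osc[OF assms]) simp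
  ultimately show ?thesis using negligible_subset by blast
qed

section \<open>Sufficiency in the Lebesgue criterion\<close>

text \<open>Turns a Riemann sum into an integral over a real interval, so that dominated convergence
  becomes available.\<close>

lemma step_function:
  assumes tag: "tagged \<delta> n t \<xi>" and bd: "\<And>x. x \<in> T \<inter> J a b \<Longrightarrow> \<bar>h x\<bar> \<le> K"
  obtains \<phi> where "(\<phi> has_integral riemann_sum h n t \<xi>) {a..b}" "\<And>x. \<bar>\<phi> x\<bar> \<le> K"
    "\<And>i x. i < n \<Longrightarrow> t i < x \<Longrightarrow> x < t (Suc i) \<Longrightarrow> \<phi> x = h (\<xi> i)"
proof -
  have t: "t 0 = a" "t n = b" "\<forall>i<n. t i < t (Suc i)" and xi: "\<And>i. i < n \<Longrightarrow> \<xi> i \<in> T \<inter> J (t i) (t (Suc i))"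
    using tag by (auto simp: tagged_def ts_partition_def)
  have sub: "a \<le> t i \<and> t (Suc i) \<le> b" if "i < n" for i
    using partition_increasing[OF t(3), of 0 i] partition_increasing[OF t(3), of "Suc i" n] that t by auto
  have xib: "\<bar>h (\<xi> i)\<bar> \<le> K" if "i < n" for i
  proof (rule bd)
    show "\<xi> i \<in> T \<inter> J a b" using xi[OF that] sub[OF that] J by auto
  qed
  \<comment> \<open>The open subintervals are disjoint, so at most one summand is nonzero. At the
    finitely many partition points the value is \<open>0\<close>, without effect on the
    integral.\<close>
  define \<phi> where "\<phi> x = (\<Sum>i<n. if x \<in> {t i<..<t (Suc i)} then h (\<xi> i) else 0)" for x
  have val: "\<phi> x = h (\<xi> i)" if "i < n" "t i < x" "x < t (Suc i)" for i x
  proof -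
    have "x \<notin> {t j<..<t (Suc j)}" if j: "j < n" "j \<noteq> i" for j
      using partition_increasing[OF t(3), of "Suc i" j] partition_increasing[OF t(3), of "Suc j" i]
        j \<open>i < n\<close> \<open>t i < x\<close> \<open>x < t (Suc i)\<close> by (cases "i < j") auto
    then have "\<phi> x = (\<Sum>j<n. if j = i then h (\<xi> i) else 0)"
      unfolding \<phi>_def using that by (intro sum.cong) auto
    then show ?thesis using that by simp
  qed
  \<comment> \<open>\<open>K\<close> must also dominate the value \<open>0\<close> taken off the
    open subintervals; \<open>a < b\<close> guarantees at least one tag.\<close>
  have K: "0 \<le> K" using xib[of 0] t ab by (cases n) auto
  show ?thesis
  proof (rule that)
    have "((\<lambda>x. if x \<in> {t i<..<t (Suc i)} then h (\<xi> i) else 0) has_integral h (\<xi> i) * (t (Suc i) - t i)) {a..b}"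
      if i: "i < n" for i
    proof -
      have "((\<lambda>x. h (\<xi> i)) has_integral h (\<xi> i) * (t (Suc i) - t i)) {t i..t (Suc i)}"
        using has_integral_const_real[of "h (\<xi> i)" "t i" "t (Suc i)"] t(3) i by (simp add: mult.commute less_imp_le)
      then have "((\<lambda>x. h (\<xi> i)) has_integral h (\<xi> i) * (t (Suc i) - t i)) {t i<..<t (Suc i)}"
        by (simp add: has_integral_Icc_iff_Ioo)
      moreover have "{t i<..<t (Suc i)} \<subseteq> {a..b}" using sub[OF i] by auto
      ultimately show ?thesis by (simp only: has_integral_restrict)
    qed
    then show "(\<phi> has_integral riemann_sum h n t \<xi>) {a..b}"
      unfolding \<phi>_def by (intro has_integral_sum) auto
    show "\<bar>\<phi> x\<bar> \<le> K" for x
    proof (cases "\<exists>i<n. x \<in> {t i<..<t (Suc i)}")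
      case False
      then have "\<phi> x = 0" unfolding \<phi>_def by (intro sum.neutral) auto
      then show ?thesis using K by simp
    qed (use val xib in auto)
  qed (use val in auto)
qed

text \<open>The almost everywhere limit of the step functions behind the Riemann sums. In a gap of \<open>T\<close>
  it is constant, with the value of \<open>h\<close> at the only point of \<open>T\<close> that can be a tag there.\<close>

definition filled :: "(real \<Rightarrow> real) \<Rightarrow> real \<Rightarrow> real" where
  "filled h x = (if x \<in> T then h x
     else h (SOME y. y \<in> T \<inter> J (Sup (T \<inter> {..x})) (Inf (T \<inter> {x..}))))"

text \<open>\<open>u\<close> and \<open>v\<close> are neighbours in \<open>T\<close>, so the
  supremum and infimum in \<open>filled\<close> return them, and the choice operator has a single
  candidate.\<close>

lemma filled_gap:
  assumes "u \<in> T" "v \<in> T" "u < x" "x < v" "T \<inter> {u<..<v} = {}" "y \<in> T \<inter> J u v"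
  shows "filled h x = h y"
proof -
  have "Sup (T \<inter> {..x}) = u" "Inf (T \<inter> {x..}) = v"
    using assms by (intro cSup_eq_maximum cInf_eq_minimum; force)+
  moreover have "(SOME y. y \<in> T \<inter> J u v) = y"
    using J_gap[OF assms(5)] assms(6) by (metis someI)
  ultimately show ?thesis using assms(3-5) unfolding filled_def by auto
qed

text \<open>If \<open>x\<close> is in \<open>T\<close>, its subinterval is no gap, hence has length
  at most \<open>\<delta> m\<close>; the tags tend to \<open>x\<close> and continuity applies. If
  \<open>x\<close> is not in \<open>T\<close>, closedness gives it a positive distance
  \<open>e\<close> from \<open>T\<close>, and once \<open>\<delta> m < e\<close> its subinterval is
  a gap, where the step function has exactly the value of \<open>filled h\<close>.\<close>

lemma steps_converge:
  assumes tag: "\<And>m. tagged (\<delta> m) (n m) (t m) (\<xi> m)" and \<delta>: "\<delta> \<longlonglongrightarrow> 0"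
    and x: "x \<in> {a..b}" "\<And>m. x \<notin> t m ` {..n m}" "x \<notin> ts_discont T a b h"
    and \<phi>: "\<And>m i x. i < n m \<Longrightarrow> t m i < x \<Longrightarrow> x < t m (Suc i) \<Longrightarrow> \<phi> m x = h (\<xi> m i)"
  shows "(\<lambda>m. \<phi> m x) \<longlonglongrightarrow> filled h x"
proof -
  have t: "t m 0 = a" "t m (n m) = b" and tT: "\<And>i. i \<le> n m \<Longrightarrow> t m i \<in> T" for m
    using tag[of m] by (auto simp: tagged_def ts_partition_def)
  have "x \<noteq> a" "x \<noteq> b"
    using x(2)[of 0] t[of 0] by (metis atMost_iff imageI le0, metis atMost_iff imageI order_refl)
  then have xab: "a < x" "x < b" using x(1) by auto
  have "\<exists>i<n m. t m i < x \<and> x < t m (Suc i)" for m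
  proof -
    obtain i where "i < n m" "t m i \<le> x" "x < t m (Suc i)"
      using partition_locate[of "t m" x "n m"] t xab by auto
    moreover have "x \<noteq> t m i" using x(2)[of m] \<open>i < n m\<close> by auto
    ultimately show ?thesis by force
  qed
  then obtain i where i: "\<And>m. i m < n m" "\<And>m. t m (i m) < x" "\<And>m. x < t m (Suc (i m))" by metis
  have val: "\<phi> m x = h (\<xi> m (i m))" for m using \<phi> i by blast
  have xi: "\<xi> m (i m) \<in> T" "\<xi> m (i m) \<in> J (t m (i m)) (t m (Suc (i m)))" for m
    using tag[of m] i(1)[of m] by (auto simp: tagged_def)
  have bnd: "t m (i m) \<le> \<xi> m (i m)" "\<xi> m (i m) \<le> t m (Suc (i m))" for m
    using xi(2)[of m] J_bounds(2) by force+
  have gap: "T \<inter> {t m (i m)<..<t m (Suc (i m))} = {}" if "t m (Suc (i m)) - t m (i m) > \<delta> m" for m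
    using ts_partition_gap tag[of m] i(1)[of m] that unfolding tagged_def by blast
  have vT: "t m (i m) \<in> T" "t m (Suc (i m)) \<in> T" for m using tT i(1)[of m] by auto
  show ?thesis
  proof (cases "x \<in> T")
    case True
    have "\<bar>\<xi> m (i m) - x\<bar> \<le> \<delta> m" for m
      using gap[of m] True i(2,3)[of m] bnd[of m] by (cases "t m (Suc (i m)) - t m (i m) > \<delta> m") auto
    then have "(\<lambda>m. \<xi> m (i m) - x) \<longlonglongrightarrow> 0"
      by (intro Lim_null_comparison[OF _ \<delta>]) auto
    then have "(\<lambda>m. \<xi> m (i m)) \<longlonglongrightarrow> x" by (simp add: LIM_zero_iff)
    moreover have "continuous (at x within T) h"
      using x(3) True xab by (auto simp: ts_discont_def)
    ultimately have "(\<lambda>m. h (\<xi> m (i m))) \<longlonglongrightarrow> h x"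
      by (intro continuous_within_tendsto_compose'[of x T h]) (use xi(1) in auto)
    then show ?thesis using True by (simp add: val filled_def)
  next
    case False
    then obtain e where e: "e > 0" "\<And>y. y \<in> T \<Longrightarrow> dist x y \<ge> e"
      using separate_point_closed[OF closed] by blast
    have "\<forall>\<^sub>F m in sequentially. \<delta> m < e" using order_tendstoD(2)[OF \<delta> e(1)] .
    then have "\<forall>\<^sub>F m in sequentially. \<phi> m x = filled h x"
    proof eventually_elim
      case (elim m)
      have "t m (Suc (i m)) - t m (i m) > \<delta> m"
        using e(2)[OF vT(1)[of m]] elim i(2,3)[of m] by (auto simp: dist_real_def)
      then show ?case
        using filled_gap[OF vT(1)[of m] vT(2)[of m] i(2,3) gap] xi[of m] val[of m] by simp
    qed
    then show ?thesis by (rule tendsto_eventually)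
  qed
qed

text \<open>Dominated convergence with constant bound \<open>K\<close>, off a null set made of the
  discontinuities and the countably many points of all the partitions.\<close>

lemma riemann_sums_converge:
  assumes tag: "\<And>m. tagged (\<delta> m) (n m) (t m) (\<xi> m)" and \<delta>: "\<delta> \<longlonglongrightarrow> 0"
    and bd: "bounded (h ` (T \<inter> J a b))" and neg: "negligible (ts_discont T a b h)"
  shows "(\<lambda>m. riemann_sum h (n m) (t m) (\<xi> m)) \<longlonglongrightarrow> integral {a..b} (filled h)"
proof -
  obtain K where K: "\<And>x. x \<in> T \<inter> J a b \<Longrightarrow> \<bar>h x\<bar> \<le> K" using bd unfolding bounded_iff by auto
  have "\<exists>\<phi>. (\<phi> has_integral riemann_sum h (n m) (t m) (\<xi> m)) {a..b} \<and> (\<forall>x. \<bar>\<phi> x\<bar> \<le> K) \<and>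
    (\<forall>i x. i < n m \<longrightarrow> t m i < x \<longrightarrow> x < t m (Suc i) \<longrightarrow> \<phi> x = h (\<xi> m i))" for m
    by (rule step_function[OF tag[of m] K]) auto
  then obtain \<phi> where \<phi>: "\<And>m. (\<phi> m has_integral riemann_sum h (n m) (t m) (\<xi> m)) {a..b}"
    "\<And>m x. \<bar>\<phi> m x\<bar> \<le> K" "\<And>m i x. i < n m \<Longrightarrow> t m i < x \<Longrightarrow> x < t m (Suc i) \<Longrightarrow> \<phi> m x = h (\<xi> m i)"
    by metis
  define N where "N = ts_discont T a b h \<union> (\<Union>m. t m ` {..n m})"
  define S where "S = {a..b} - N"
  have "negligible N" unfolding N_def
    by (intro negligible_Un neg negligible_Union_nat negligible_finite) simp
  then have N: "negligible ({a..b} - S \<union> (S - {a..b}))"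
    by (rule negligible_subset) (auto simp: S_def)
  have int: "integral S f = integral {a..b} f" for f :: "real \<Rightarrow> real"
    using N by (intro integral_spike_set; elim negligible_subset) auto
  have "(\<lambda>m. integral S (\<phi> m)) \<longlonglongrightarrow> integral S (filled h)"
  proof (rule dominated_convergence(2))
    show "\<phi> m integrable_on S" for m
      using \<phi>(1) integrable_spike_set_eq[OF N] by blast
    show "(\<lambda>x. K) integrable_on S"
      using integrable_const_ivl integrable_spike_set_eq[OF N] by blast
    show "norm (\<phi> m x) \<le> K" for m x using \<phi>(2) by simp
    show "(\<lambda>m. \<phi> m x) \<longlonglongrightarrow> filled h x" if "x \<in> S" for x
      by (rule steps_converge[where t=t and \<xi>=\<xi> and n=n, OF tag \<delta>]) (use that \<phi>(3) in \<open>auto simp: S_def N_def\<close>)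
  qed
  then show ?thesis unfolding int integral_unique[OF \<phi>(1)] .
qed

text \<open>Otherwise bad tagged partitions for \<open>\<delta>\<close> equal to
  \<open>inverse (real (Suc m))\<close> would form a sequence whose sums stay at least
  \<open>e\<close> away, against the sequential convergence.\<close>

lemma has_int_filled:
  assumes "bounded (h ` (T \<inter> J a b))" "negligible (ts_discont T a b h)"
  shows "has_int h (integral {a..b} (filled h))"
proof (rule ccontr)
  assume "\<not> ?thesis"
  then obtain e where e: "e > 0" and bad: "\<And>d. d > 0 \<Longrightarrow>
      \<exists>n t \<xi>. tagged d n t \<xi> \<and> \<bar>riemann_sum h n t \<xi> - integral {a..b} (filled h)\<bar> \<ge> e"
    unfolding has_int_def by (metis not_less)
  have "\<forall>m. \<exists>n t \<xi>. tagged (inverse (real (Suc m))) n t \<xi> \<and> \<bar>riemann_sum h n t \<xi> - integral {a..b} (filled h)\<bar> \<ge> e"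
    by (intro allI bad) simp
  then obtain n t \<xi> where tag: "\<And>m. tagged (inverse (real (Suc m))) (n m) (t m) (\<xi> m)"
    and far: "\<And>m. \<bar>riemann_sum h (n m) (t m) (\<xi> m) - integral {a..b} (filled h)\<bar> \<ge> e" by metis
  from tendstoD[OF riemann_sums_converge[OF tag LIMSEQ_inverse_real_of_nat assms] e]
  obtain m where "\<bar>riemann_sum h (n m) (t m) (\<xi> m) - integral {a..b} (filled h)\<bar> < e"
    by (auto simp: eventually_sequentially dist_real_def)
  then show False using far[of m] by linarith
qed

text \<open>The definite description is the one to which \<open>delta_integral\<close> and
  \<open>nabla_integral\<close> unfold, so limits of sums can be read as these integrals.\<close>

lemma riemann_sums_tendsto:
  assumes "\<And>m. tagged (\<delta> m) (n m) (t m) (\<xi> m)" "\<delta> \<longlonglongrightarrow> 0" "has_int h I"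
  shows "(\<lambda>m. riemann_sum h (n m) (t m) (\<xi> m)) \<longlonglongrightarrow> (THE I. has_int h I)"
proof -
  have h: "bounded (h ` (T \<inter> J a b))" "negligible (ts_discont T a b h)"
    using assms(3) has_int_bounded has_int_negligible_discont by auto
  have "(THE I. has_int h I) = integral {a..b} (filled h)"
    using has_int_filled[OF h] has_int_unique[OF _ has_int_filled[OF h]] by (rule the_equality)
  with riemann_sums_converge[OF assms(1,2) h] show ?thesis by (simp only:)
qed

text \<open>Only the boundedness condition depends on \<open>J\<close>, and there only through the
  endpoint that \<open>J a b\<close> contains. This makes delta and nabla integrability
  comparable.\<close>

lemma lebesgue_criterion:
  "(\<exists>I. has_int h I) \<longleftrightarrow> bounded (h ` (T \<inter> J a b)) \<and> negligible (ts_discont T a b h)"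
  using has_int_bounded has_int_negligible_discont has_int_filled by blast

end

section \<open>Jump operators and the weights\<close>

lemma forward_jump_ge:
  assumes "t \<in> T"
  shows "t \<le> forward_jump T t"
proof (cases "{s \<in> T. s > t} = {}")
  case True
  then have "s \<le> t" if "s \<in> T" for s using that by (simp add: not_less)
  then have "Sup T = t" using assms by (intro cSup_eq_maximum)
  then show ?thesis using True by (simp add: forward_jump_def)
next
  case False
  then have "t \<le> Inf {s \<in> T. s > t}" by (intro cInf_greatest) auto
  then show ?thesis unfolding forward_jump_def if_not_P[OF False] .
qed

lemma backward_jump_le:
  assumes "t \<in> T"
  shows "backward_jump T t \<le> t"
proof (cases "{s \<in> T. s < t} = {}")
  case True
  then have "t \<le> s" if "s \<in> T" for s using that by (simp add: not_less)
  then have "Inf T = t" using assms by (intro cInf_eq_minimum)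
  then show ?thesis using True by (simp add: backward_jump_def)
next
  case False
  then have "Sup {s \<in> T. s < t} \<le> t" by (intro cSup_least) auto
  then show ?thesis unfolding backward_jump_def if_not_P[OF False] .
qed

text \<open>For \<open>s \<noteq> t\<close> both quotients reduce to
  \<open>(t - s) / (2 * t - 2 * s)\<close>; at \<open>s = t\<close> the denominator
  vanishes.\<close>

lemma gamma_dense:
  assumes "forward_jump T t = t" "backward_jump T t = t"
  shows "gamma1 T t = 1 / 2" "gamma2 T t = 1 / 2"
proof -
  have "\<forall>\<^sub>F s in at t. (t - s) / (t + 2 * t - 2 * s - t) = 1 / 2"
    by (rule eventually_mono[OF eventually_neq_at_within[of t t UNIV]]) (simp add: field_simps)
  moreover have "\<forall>\<^sub>F s in at t. (2 * t - s - t) / (t + 2 * t - 2 * s - t) = 1 / 2"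
    by (rule eventually_mono[OF eventually_neq_at_within[of t t UNIV]]) (simp add: field_simps)
  ultimately show "gamma1 T t = 1 / 2" "gamma2 T t = 1 / 2"
    unfolding gamma1_def gamma2_def assms by (intro tendsto_Lim tendsto_eventually; simp)+
qed

text \<open>At \<open>s = t\<close> the denominator is the positive distance between the two jumps,
  so the quotients are continuous there and the limits are their values.\<close>

lemma gamma_scattered:
  assumes "backward_jump T t < forward_jump T t"
  shows "gamma1 T t = (forward_jump T t - t) / (forward_jump T t - backward_jump T t)"
    and "gamma2 T t = (t - backward_jump T t) / (forward_jump T t - backward_jump T t)"
  unfolding gamma1_def gamma2_def using assms
  by (intro tendsto_Lim; auto intro!: tendsto_eq_intros)+

text \<open>The jumps enclose \<open>t\<close>, so either they are distinct and the weights split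
  their distance at \<open>t\<close>, or both equal \<open>t\<close>.\<close>

lemma gamma_weights:
  assumes "t \<in> T"
  shows "0 \<le> gamma1 T t" "0 \<le> gamma2 T t" "gamma1 T t + gamma2 T t = 1"
proof -
  note j = forward_jump_ge[OF assms] backward_jump_le[OF assms]
  have "0 \<le> gamma1 T t \<and> 0 \<le> gamma2 T t \<and> gamma1 T t + gamma2 T t = 1"
  proof (cases "backward_jump T t < forward_jump T t")
    case True
    then show ?thesis using j by (simp add: gamma_scattered add_divide_distrib[symmetric])
  next
    case False
    then have "forward_jump T t = t" "backward_jump T t = t" using j by linarith+
    then show ?thesis by (simp add: gamma_dense)
  qed
  then show "0 \<le> gamma1 T t" "0 \<le> gamma2 T t" "gamma1 T t + gamma2 T t = 1" by auto
qed

lemma bounded_image_real_iff: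
  fixes f :: "'a \<Rightarrow> real"
  shows "bounded (f ` S) \<longleftrightarrow> (\<exists>K. \<forall>t\<in>S. \<bar>f t\<bar> \<le> K)"
  by (auto simp: bounded_iff)

section \<open>Hoelder's inequality for finite weighted sums\<close>

text \<open>Young's inequality applied termwise to \<open>\<bar>x i\<bar> / u\<close> and
  \<open>\<bar>y i\<bar> / v\<close>, with \<open>u\<close> and \<open>v\<close> the weighted norms.
  The general index type admits a disjoint sum of index sets later.\<close>

lemma Holder_inequality_sum:
  fixes w x y :: "'a \<Rightarrow> real"
  assumes fin: "finite A" and w: "\<And>i. i \<in> A \<Longrightarrow> 0 \<le> w i" and p: "p > 1" and q: "q = p / (p - 1)"
  shows "(\<Sum>i\<in>A. w i * \<bar>x i * y i\<bar>)
    \<le> (\<Sum>i\<in>A. w i * \<bar>x i\<bar> powr p) powr (1 / p) * (\<Sum>i\<in>A. w i * \<bar>y i\<bar> powr q) powr (1 / q)"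
    (is "?S \<le> ?X powr _ * ?Y powr _")
proof (cases "?X = 0 \<or> ?Y = 0")
  case True
  \<comment> \<open>A vanishing sum of nonnegative terms forces a zero weight or a zero value at
    each index, so the left side vanishes too.\<close>
  then have "(\<forall>i\<in>A. w i * \<bar>x i\<bar> powr p = 0) \<or> (\<forall>i\<in>A. w i * \<bar>y i\<bar> powr q = 0)"
    using fin w by (subst (asm) (1 2) sum_nonneg_eq_0_iff) auto
  then have "?S = 0" by (intro sum.neutral) auto
  then show ?thesis by simp
next
  case False
  have X: "0 < ?X" and Y: "0 < ?Y"
    using False w by (auto simp: less_le intro!: sum_nonneg mult_nonneg_nonneg)
  have q1: "q > 1" using p q by simp
  have pq: "1 / p + 1 / q = 1" unfolding q using p by (simp add: field_simps)
  define u v where "u = ?X powr (1 / p)" and "v = ?Y powr (1 / q)"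
  have uv: "0 < u" "0 < v" using X Y by (auto simp: u_def v_def)
  have up: "u powr p = ?X" "v powr q = ?Y"
    using X Y p q1 by (simp_all add: u_def v_def powr_powr)
  have "?S / (u * v) = (\<Sum>i\<in>A. w i * ((\<bar>x i\<bar> / u) * (\<bar>y i\<bar> / v)))"
    by (simp add: sum_divide_distrib abs_mult)
  also have "\<dots> \<le> (\<Sum>i\<in>A. w i * ((\<bar>x i\<bar> / u) powr p / p + (\<bar>y i\<bar> / v) powr q / q))"
    using uv by (intro sum_mono mult_left_mono Youngs_inequality p q1 pq w) auto
  \<comment> \<open>By \<open>up\<close>, the scaling divides the powers by \<open>?X\<close> and
    \<open>?Y\<close>, so the two parts contribute \<open>1 / p\<close> and
    \<open>1 / q\<close>.\<close>
  also have "\<dots> = (\<Sum>i\<in>A. w i * \<bar>x i\<bar> powr p / (?X * p) + w i * \<bar>y i\<bar> powr q / (?Y * q))"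
    using uv by (intro sum.cong) (simp_all add: powr_divide up algebra_simps)
  also have "\<dots> = ?X / (?X * p) + ?Y / (?Y * q)"
    by (simp only: sum.distrib sum_divide_distrib)
  also have "\<dots> = 1" using X Y pq by simp
  finally show ?thesis using uv by (simp add: field_simps flip: u_def v_def)
qed

section \<open>Diamond integrability and its closure properties\<close>

context ts_interval
begin

interpretation delta: ts_integral T a b "\<lambda>u v. {u..<v}"
  by unfold_locales simp

interpretation nabla: ts_integral T a b "\<lambda>u v. {u<..v}"
  by unfold_locales simp

lemma has_delta_integral_eq: "has_delta_integral T a b = delta.has_int"
  unfolding has_delta_integral_def delta.has_int_def delta.tagged_def by (intro ext) blast

lemma has_nabla_integral_eq: "has_nabla_integral T a b = nabla.has_int"
  unfolding has_nabla_integral_def nabla.has_int_def nabla.tagged_def by (intro ext) blast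

text \<open>The Lebesgue criterion for both parts, with the two boundedness conditions merged: the
  weights sum to \<open>1\<close>, which recovers \<open>f\<close> from its weighted parts, and
  conversely each weight is at most \<open>1\<close>.\<close>

lemma diamond_integrable_iff:
  "diamond_integrable T a b f \<longleftrightarrow> bounded (f ` (T \<inter> {a..b}))
     \<and> negligible (ts_discont T a b (\<lambda>t. gamma1 T t * f t))
     \<and> negligible (ts_discont T a b (\<lambda>t. gamma2 T t * f t))"
proof -
  have "bounded ((\<lambda>t. gamma1 T t * f t) ` (T \<inter> {a..<b})) \<and> bounded ((\<lambda>t. gamma2 T t * f t) ` (T \<inter> {a<..b}))
      \<longleftrightarrow> bounded (f ` (T \<inter> {a..b}))" (is "?L \<longleftrightarrow> ?R")
  proof
    assume ?L
    then obtain K L where K: "\<And>t. t \<in> T \<inter> {a..<b} \<Longrightarrow> \<bar>gamma1 T t * f t\<bar> \<le> K"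
      and L: "\<And>t. t \<in> T \<inter> {a<..b} \<Longrightarrow> \<bar>gamma2 T t * f t\<bar> \<le> L"
      unfolding bounded_image_real_iff by blast
    \<comment> \<open>The delta tags omit \<open>b\<close> and the nabla tags omit \<open>a\<close>,
      so the endpoint values enter the bound separately. The absolute value of \<open>K + L\<close>
      keeps the bound valid there whatever the sign of the sum.\<close>
    have "\<bar>f t\<bar> \<le> \<bar>f a\<bar> + \<bar>f b\<bar> + \<bar>K + L\<bar>" if "t \<in> T \<inter> {a..b}" for t
    proof (cases "t = a \<or> t = b")
      case False
      then have t: "t \<in> T \<inter> {a..<b}" "t \<in> T \<inter> {a<..b}" using that by auto
      have "f t = gamma1 T t * f t + gamma2 T t * f t"
        using gamma_weights(3)[of t T] that by (simp flip: distrib_right)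
      then show ?thesis using K[OF t(1)] L[OF t(2)] by linarith
    qed auto
    then show ?R unfolding bounded_image_real_iff by blast
  next
    assume ?R
    then obtain K where K: "\<And>t. t \<in> T \<inter> {a..b} \<Longrightarrow> \<bar>f t\<bar> \<le> K"
      unfolding bounded_image_real_iff by blast
    have "\<bar>gamma1 T t * f t\<bar> \<le> K \<and> \<bar>gamma2 T t * f t\<bar> \<le> K" if t: "t \<in> T \<inter> {a..b}" for t
    proof -
      have "gamma1 T t \<le> 1" "gamma2 T t \<le> 1" using gamma_weights[of t T] t by auto
      then have "gamma1 T t * \<bar>f t\<bar> \<le> 1 * \<bar>f t\<bar>" "gamma2 T t * \<bar>f t\<bar> \<le> 1 * \<bar>f t\<bar>"
        by (intro mult_right_mono; simp)+
      then show ?thesis using gamma_weights[of t T] t K[OF t] by (auto simp: abs_mult)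
    qed
    then show ?L unfolding bounded_image_real_iff by (auto intro!: exI[of _ K])
  qed
  then show ?thesis
    unfolding diamond_integrable_def delta_integrable_def nabla_integrable_def
      has_delta_integral_eq has_nabla_integral_eq delta.lebesgue_criterion nabla.lebesgue_criterion
    by blast
qed

lemma diamond_integrable_negligible_discont:
  assumes "diamond_integrable T a b f"
  shows "negligible (ts_discont T a b f)"
proof -
  have "ts_discont T a b f \<subseteq> ts_discont T a b (\<lambda>t. gamma1 T t * f t) \<union> ts_discont T a b (\<lambda>t. gamma2 T t * f t)"
  proof
    fix x assume x: "x \<in> ts_discont T a b f"
    show "x \<in> ts_discont T a b (\<lambda>t. gamma1 T t * f t) \<union> ts_discont T a b (\<lambda>t. gamma2 T t * f t)"
    proof (rule ccontr)
      assume "\<not> ?thesis"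
      then have "continuous (at x within T) (\<lambda>t. gamma1 T t * f t + gamma2 T t * f t)"
        using x by (intro continuous_add) (auto simp: ts_discont_def)
      \<comment> \<open>The weights are known to sum to \<open>1\<close> on \<open>T\<close>, so the
        sum is replaced by \<open>f\<close> within \<open>T\<close> only.\<close>
      then have "continuous (at x within T) f"
        by (rule continuous_transform_within[OF _ zero_less_one])
          (use x gamma_weights(3) in \<open>auto simp: ts_discont_def simp flip: distrib_right\<close>)
      then show False using x by (simp add: ts_discont_def)
    qed
  qed
  then show ?thesis using assms diamond_integrable_iff negligible_Un negligible_subset by meson
qed

text \<open>The weight stays attached to \<open>f\<close>, and \<open>k\<close> enters unweighted; a
  weighted product is continuous wherever the weighted \<open>f\<close> and \<open>k\<close>
  are.\<close>

lemma diamond_integrable_mult: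
  assumes f: "diamond_integrable T a b f"
    and k: "bounded (k ` (T \<inter> {a..b}))" "negligible (ts_discont T a b k)"
  shows "diamond_integrable T a b (\<lambda>t. f t * k t)"
proof -
  have f': "bounded (f ` (T \<inter> {a..b}))" "negligible (ts_discont T a b (\<lambda>t. gamma1 T t * f t))"
    "negligible (ts_discont T a b (\<lambda>t. gamma2 T t * f t))"
    using f by (auto simp: diamond_integrable_iff)
  obtain K L where K: "\<And>t. t \<in> T \<inter> {a..b} \<Longrightarrow> \<bar>f t\<bar> \<le> K" and L: "\<And>t. t \<in> T \<inter> {a..b} \<Longrightarrow> \<bar>k t\<bar> \<le> L"
    using f'(1) k(1) unfolding bounded_image_real_iff by blast
  have "\<bar>f t * k t\<bar> \<le> K * L" if "t \<in> T \<inter> {a..b}" for t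
    unfolding abs_mult using K[OF that] L[OF that] by (intro mult_mono) auto
  then have "bounded ((\<lambda>t. f t * k t) ` (T \<inter> {a..b}))"
    unfolding bounded_image_real_iff by blast
  \<comment> \<open>\<open>g\<close> stands for either weight.\<close>
  moreover have "ts_discont T a b (\<lambda>t. g t * (f t * k t)) \<subseteq> ts_discont T a b (\<lambda>t. g t * f t) \<union> ts_discont T a b k"
    for g unfolding ts_discont_def mult.assoc[symmetric] by (auto intro: continuous_mult)
  ultimately show ?thesis
    unfolding diamond_integrable_iff using f'(2,3) k(2) negligible_Un negligible_subset by meson
qed

text \<open>The weights are nonnegative on \<open>T\<close>, so they can be moved inside the
  absolute value, which is continuous.\<close>

lemma diamond_integrable_abs:
  assumes "diamond_integrable T a b f"
  shows "diamond_integrable T a b (\<lambda>t. \<bar>f t\<bar>)"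
proof -
  have "ts_discont T a b (\<lambda>t. g t * \<bar>f t\<bar>) \<subseteq> ts_discont T a b (\<lambda>t. g t * f t)"
    if g: "\<And>t. t \<in> T \<Longrightarrow> 0 \<le> g t" for g
  proof
    fix x assume x: "x \<in> ts_discont T a b (\<lambda>t. g t * \<bar>f t\<bar>)"
    have "continuous (at x within T) (\<lambda>t. g t * \<bar>f t\<bar>)" if "continuous (at x within T) (\<lambda>t. g t * f t)"
      by (rule continuous_transform_within[OF continuous_rabs[OF that] zero_less_one])
        (use x g in \<open>auto simp: ts_discont_def abs_mult\<close>)
    then show "x \<in> ts_discont T a b (\<lambda>t. g t * f t)" using x by (auto simp: ts_discont_def)
  qed
  from this[of "gamma1 T"] this[of "gamma2 T"] show ?thesis
    using assms gamma_weights(1,2) unfolding diamond_integrable_iff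
    by (auto simp: bounded_iff intro: negligible_subset)
qed

text \<open>Splitting off one factor \<open>\<bar>f t\<bar>\<close> lets the weight act on a first
  power of \<open>f\<close>, leaving the exponent \<open>r - 1\<close> for the unweighted
  factor.\<close>

lemma diamond_integrable_powr:
  assumes f: "diamond_integrable T a b f" and r: "r > 1"
  shows "diamond_integrable T a b (\<lambda>t. \<bar>f t\<bar> powr r)"
proof -
  obtain K where K: "\<And>t. t \<in> T \<inter> {a..b} \<Longrightarrow> \<bar>f t\<bar> \<le> K"
    using f unfolding diamond_integrable_iff bounded_image_real_iff by blast
  have "diamond_integrable T a b (\<lambda>t. \<bar>f t\<bar> * \<bar>f t\<bar> powr (r - 1))"
  proof (rule diamond_integrable_mult[OF diamond_integrable_abs[OF f]])
    show "bounded ((\<lambda>t. \<bar>f t\<bar> powr (r - 1)) ` (T \<inter> {a..b}))"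
      unfolding bounded_iff using K r by (auto intro!: exI[of _ "K powr (r - 1)"] powr_mono2)
    \<comment> \<open>The exponent \<open>r - 1\<close> is positive, so the power is continuous at
      zeros of \<open>f\<close> as well.\<close>
    have "ts_discont T a b (\<lambda>t. \<bar>f t\<bar> powr (r - 1)) \<subseteq> ts_discont T a b f"
      unfolding ts_discont_def continuous_within
      using r by (auto intro!: tendsto_powr' tendsto_rabs tendsto_const)
    then show "negligible (ts_discont T a b (\<lambda>t. \<bar>f t\<bar> powr (r - 1)))"
      using diamond_integrable_negligible_discont[OF f] negligible_subset by blast
  qed
  then show ?thesis by (simp add: powr_mult_base)
qed

lemma diamond_integrable_abs_mult:
  assumes "diamond_integrable T a b f" "diamond_integrable T a b g"
  shows "diamond_integrable T a b (\<lambda>t. \<bar>f t * g t\<bar>)"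
proof -
  have "bounded (g ` (T \<inter> {a..b}))" using assms(2) by (simp add: diamond_integrable_iff)
  then show ?thesis
    using diamond_integrable_abs diamond_integrable_mult diamond_integrable_negligible_discont assms by blast
qed

section \<open>Hoelder's inequality for diamond sums and passage to the limit\<close>

text \<open>One partition carries both sums, with separate tags because the two kinds of tag
  interval differ.\<close>

definition diamond_sum ::
    "(real \<Rightarrow> real) \<Rightarrow> nat \<Rightarrow> (nat \<Rightarrow> real) \<Rightarrow> (nat \<Rightarrow> real) \<Rightarrow> (nat \<Rightarrow> real) \<Rightarrow> real" where
  "diamond_sum h n t \<xi> \<zeta> = (\<Sum>i<n. gamma1 T (\<xi> i) * h (\<xi> i) * (t (Suc i) - t i))
    + (\<Sum>i<n. gamma2 T (\<zeta> i) * h (\<zeta> i) * (t (Suc i) - t i))"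

lemma diamond_sums_tendsto:
  assumes "\<And>m. delta.tagged (\<delta> m) (n m) (t m) (\<xi> m)" "\<And>m. nabla.tagged (\<delta> m) (n m) (t m) (\<zeta> m)"
    and "\<delta> \<longlonglongrightarrow> 0" and "diamond_integrable T a b h"
  shows "(\<lambda>m. diamond_sum h (n m) (t m) (\<xi> m) (\<zeta> m)) \<longlonglongrightarrow> diamond_integral T a b h"
proof -
  obtain I I' where "delta.has_int (\<lambda>t. gamma1 T t * h t) I" "nabla.has_int (\<lambda>t. gamma2 T t * h t) I'"
    using assms(4) unfolding diamond_integrable_def delta_integrable_def nabla_integrable_def
      has_delta_integral_eq has_nabla_integral_eq by auto
  from tendsto_add[OF delta.riemann_sums_tendsto[OF assms(1,3) this(1)] nabla.riemann_sums_tendsto[OF assms(2,3) this(2)]]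
  show ?thesis
    unfolding diamond_sum_def diamond_integral_def delta_integral_def nabla_integral_def
      has_delta_integral_eq has_nabla_integral_eq .
qed

text \<open>Indexing by the disjoint sum of two copies of \<open>{..<n}\<close> merges both sums
  into one, whose nonnegative weights are \<open>gamma1\<close> or \<open>gamma2\<close> at the tag
  times the length of the subinterval.\<close>

lemma diamond_sum_Holder:
  assumes "delta.tagged \<delta> n t \<xi>" "nabla.tagged \<delta> n t \<zeta>" "p > 1" "q = p / (p - 1)"
  shows "diamond_sum (\<lambda>t. \<bar>f t * g t\<bar>) n t \<xi> \<zeta>
    \<le> diamond_sum (\<lambda>t. \<bar>f t\<bar> powr p) n t \<xi> \<zeta> powr (1 / p) * diamond_sum (\<lambda>t. \<bar>g t\<bar> powr q) n t \<xi> \<zeta> powr (1 / q)"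
proof -
  define w where "w = case_sum (\<lambda>i. gamma1 T (\<xi> i) * (t (Suc i) - t i)) (\<lambda>i. gamma2 T (\<zeta> i) * (t (Suc i) - t i))"
  define s where "s = case_sum \<xi> \<zeta>"
  have tag: "\<xi> i \<in> T" "\<zeta> i \<in> T" "t i < t (Suc i)" if "i < n" for i
    using assms(1,2) that by (auto simp: delta.tagged_def nabla.tagged_def ts_partition_def)
  have w: "0 \<le> w i" if "i \<in> {..<n} <+> {..<n}" for i
    using that tag gamma_weights(1,2) by (auto simp: w_def less_imp_le)
  have "diamond_sum h n t \<xi> \<zeta> = (\<Sum>i\<in>{..<n} <+> {..<n}. w i * h (s i))" for h
    by (simp add: diamond_sum_def sum.Plus w_def s_def mult_ac)
  then show ?thesis
    using Holder_inequality_sum[of "{..<n} <+> {..<n}" w p q "\<lambda>i. f (s i)" "\<lambda>i. g (s i)"] w assms(3,4) by simp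
qed

text \<open>Serves the limit of powers with a positive exponent, where the limit of the base may be
  \<open>0\<close>.\<close>

lemma diamond_sum_nonneg:
  assumes "delta.tagged \<delta> n t \<xi>" "nabla.tagged \<delta> n t \<zeta>" "\<And>x. 0 \<le> h x"
  shows "0 \<le> diamond_sum h n t \<xi> \<zeta>"
proof -
  have tag: "\<xi> i \<in> T" "\<zeta> i \<in> T" "t i < t (Suc i)" if "i < n" for i
    using assms(1,2) that by (auto simp: delta.tagged_def nabla.tagged_def ts_partition_def)
  show ?thesis unfolding diamond_sum_def
    by (intro add_nonneg_nonneg sum_nonneg mult_nonneg_nonneg)
      (use assms(3) tag gamma_weights(1,2) in \<open>auto simp: less_imp_le\<close>)
qed

text \<open>All three integrals are limits of sums over one common sequence of partitions and tags,
  so the inequality between sums carries over.\<close>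

lemma diamond_integral_Holder:
  assumes f: "diamond_integrable T a b f" and g: "diamond_integrable T a b g"
    and p: "p > 1" and q: "q = p / (p - 1)"
  shows "diamond_integral T a b (\<lambda>t. \<bar>f t * g t\<bar>)
     \<le> diamond_integral T a b (\<lambda>t. \<bar>f t\<bar> powr p) powr (1 / p) * diamond_integral T a b (\<lambda>t. \<bar>g t\<bar> powr q) powr (1 / q)"
proof -
  define \<delta> where "\<delta> m = inverse (real (Suc m))" for m
  have \<delta>: "\<delta> \<longlonglongrightarrow> 0" unfolding \<delta>_def by (rule LIMSEQ_inverse_real_of_nat)
  have "\<exists>n t \<xi> \<zeta>. delta.tagged (\<delta> m) n t \<xi> \<and> nabla.tagged (\<delta> m) n t \<zeta>" for m
  proof -
    obtain n t where "ts_partition T a b (\<delta> m) n t"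
      using ts_partition_exists[OF closed a b, of "\<delta> m"] ab by (auto simp: \<delta>_def)
    then show ?thesis using delta.tags_exist nabla.tags_exist by metis
  qed
  then obtain n t \<xi> \<zeta> where tag: "\<And>m. delta.tagged (\<delta> m) (n m) (t m) (\<xi> m)" "\<And>m. nabla.tagged (\<delta> m) (n m) (t m) (\<zeta> m)"
    by metis
  note lim = diamond_sums_tendsto[OF tag \<delta>]
  have q1: "q > 1" using p q by simp
  show ?thesis
  proof (rule LIMSEQ_le)
    show "(\<lambda>m. diamond_sum (\<lambda>t. \<bar>f t * g t\<bar>) (n m) (t m) (\<xi> m) (\<zeta> m))
        \<longlonglongrightarrow> diamond_integral T a b (\<lambda>t. \<bar>f t * g t\<bar>)"
      by (rule lim[OF diamond_integrable_abs_mult[OF f g]])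
    \<comment> \<open>Positive exponents and nonnegative sums also cover integrals equal to
      \<open>0\<close>.\<close>
    show "(\<lambda>m. diamond_sum (\<lambda>t. \<bar>f t\<bar> powr p) (n m) (t m) (\<xi> m) (\<zeta> m) powr (1 / p)
          * diamond_sum (\<lambda>t. \<bar>g t\<bar> powr q) (n m) (t m) (\<xi> m) (\<zeta> m) powr (1 / q))
        \<longlonglongrightarrow> diamond_integral T a b (\<lambda>t. \<bar>f t\<bar> powr p) powr (1 / p)
          * diamond_integral T a b (\<lambda>t. \<bar>g t\<bar> powr q) powr (1 / q)"
      using p q1 by (intro tendsto_mult tendsto_powr' tendsto_const lim diamond_integrable_powr f g)
        (auto intro!: always_eventually diamond_sum_nonneg[OF tag])
    show "\<exists>N. \<forall>m\<ge>N. diamond_sum (\<lambda>t. \<bar>f t * g t\<bar>) (n m) (t m) (\<xi> m) (\<zeta> m)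
        \<le> diamond_sum (\<lambda>t. \<bar>f t\<bar> powr p) (n m) (t m) (\<xi> m) (\<zeta> m) powr (1 / p)
          * diamond_sum (\<lambda>t. \<bar>g t\<bar> powr q) (n m) (t m) (\<xi> m) (\<zeta> m) powr (1 / q)"
      using diamond_sum_Holder[OF tag p q] by blast
  qed
qed

end

text \<open>The integrability claims accompany the inequality because
  \<open>diamond_integral\<close> rests on definite descriptions, which are meaningful for
  integrable functions.\<close>

theorem theorem8p3p6:
  fixes T :: "real set" and a b p q :: real and f g :: "real \<Rightarrow> real"
  assumes "time_scale T"
    and "a \<in> T" and "b \<in> T" and "a < b"
    and "diamond_integrable T a b f"
    and "diamond_integrable T a b g"
    and "p > 1" and "q = p / (p - 1)"
  shows "diamond_integrable T a b (\<lambda>t. \<bar>f t * g t\<bar>) \<and>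
         diamond_integrable T a b (\<lambda>t. \<bar>f t\<bar> powr p) \<and>
         diamond_integrable T a b (\<lambda>t. \<bar>g t\<bar> powr q) \<and>
         diamond_integral T a b (\<lambda>t. \<bar>f t * g t\<bar>)
           \<le> (diamond_integral T a b (\<lambda>t. \<bar>f t\<bar> powr p)) powr (1 / p) *
             (diamond_integral T a b (\<lambda>t. \<bar>g t\<bar> powr q)) powr (1 / q)"
proof -
  interpret ts_interval T a b
    using assms(1-4) by unfold_locales (auto simp: time_scale_def)
  have "q > 1" using assms(7,8) by simp
  then show ?thesis
    using diamond_integrable_abs_mult diamond_integrable_powr diamond_integral_Holder assms(5-8) by blast
qed

end
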